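(* Let $\gamma\in(0,2]$, $b\in(-1,1)$ and $\sigma>0$. For $a>0$ let $\lambda=\sigma/a^{\gamma/2}$, let $X$ be a random variable with probability generating function $$\mathcal{P}(z)=\exp\left\{-\lambda\left(\arccos\frac{(1+b)z-2b}{2-(1+b)z}\right)^{\gamma}\right\},$$ and let $X^a=aX$. Then the characteristic function $$f^a(t)=\exp\left\{-\lambda\left(\arccos\frac{(1+b)e^{\mathrm{i}at}-2b}{2-(1+b)e^{\mathrm{i}at}}\right)^{\gamma}\right\}$$ of $X^a$ converges pointwise, as $a\downarrow0$, to the characteristic function of an $\alpha$-stable distribution (with $\alpha=\gamma/2$): for every $t\in\mathbb{R}$, $$f^a(t)\longrightarrow\exp\left\{-\sigma2^{\gamma}\cos\frac{\pi\gamma}{4}\left(\frac{1+b}{1-b}\right)^{\gamma/2}|t|^{\gamma/2}\left(1-\mathrm{i}\,\mathrm{sign}(t)\tan\frac{\pi\gamma}{4}\right)\right\}.$$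
   Context: For $z$ in the open unit disc or on the unit circle, $\arccos$ is understood by analytic continuation (and boundary values) from $z\in[0,1)$, so that $\mathcal{P}(z)=\mathrm{E}z^X$ and $f^a(t)=\mathrm{E}e^{\mathrm{i}taX}=\mathcal{P}(e^{\mathrm{i}at})$. The product $\cos\frac{\pi\gamma}{4}\left(1-\mathrm{i}\,\mathrm{sign}(t)\tan\frac{\pi\gamma}{4}\right)$ is read as $\cos\frac{\pi\gamma}{4}-\mathrm{i}\,\mathrm{sign}(t)\sin\frac{\pi\gamma}{4}$, which also covers $\gamma=2$ (where the limit law is degenerate). *)

theory Defs
  imports "HOL-Probability.Probability"
begin

definition pgf :: "'w measure \<Rightarrow> ('w \<Rightarrow> nat) \<Rightarrow> complex \<Rightarrow> complex" where
  "pgf M X z = (CLINT \<omega>|M. z ^ X \<omega>)"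

text \<open>
  For \<open>-1 < b < 1\<close> the Moebius map inside \<^const>\<open>Arccos\<close> sends the closed unit disc to the
  closed disc with diameter \<open>[-(1+3b)/(3+b), 1]\<close>, which meets the branch cuts of the principal
  \<^const>\<open>Arccos\<close> only in the image \<open>1\<close> of \<open>z = 1\<close>, where \<^const>\<open>Arccos\<close> is \<open>0\<close>.  Off that point
  \<^const>\<open>Arccos\<close> has positive real part.  Hence the principal branches of \<^const>\<open>Arccos\<close> and of
  the power give the analytic continuation, from \<open>[0,1)\<close> to the open unit disc, of the
  expression with the real arccosine, together with its continuous boundary values.
\<close>
definition arccos_pgf :: "real \<Rightarrow> real \<Rightarrow> real \<Rightarrow> complex \<Rightarrow> complex" where
  "arccos_pgf \<gamma> b l z =
     exp (- (of_real l *
       Arccos (((1 + of_real b) * z - 2 * of_real b) / (2 - (1 + of_real b) * z)) powr of_real \<gamma>))"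

text \<open>
  If \<open>Y, Y'\<close> are independent with law \<open>\<mu>\<close>, then for all \<open>A, B > 0\<close> the sum \<open>A Y + B Y'\<close> has the law
  of \<open>(A\<^sup>\<alpha> + B\<^sup>\<alpha>)\<^bsup>1/\<alpha>\<^esup> Y + D\<close> for some real \<open>D\<close>.  Point masses are allowed, and are stable of
  every index in this sense.
\<close>
definition stable_distribution :: "real \<Rightarrow> real measure \<Rightarrow> bool" where
  "stable_distribution \<alpha> \<mu> \<longleftrightarrow>
     0 < \<alpha> \<and> \<alpha> \<le> 2 \<and> real_distribution \<mu> \<and>
     (\<forall>A>0. \<forall>B>0. \<exists>D.
        distr (\<mu> \<Otimes>\<^sub>M \<mu>) borel (\<lambda>(x, y). A * x + B * y) =
        distr \<mu> borel (\<lambda>x. (A powr \<alpha> + B powr \<alpha>) powr (1 / \<alpha>) * x + D))"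

end

theory Submission
  imports Defs "HOL-Complex_Analysis.Conformal_Mappings"
begin

text \<open>
  Near \<open>w = 1\<close> the arccosine behaves like \<open>sqrt (2 (1 - w))\<close>.  The Moebius image \<open>w\<close> of
  \<open>exp (\<i> a t)\<close> satisfies \<open>1 - w \<sim> - 2 \<i> a t (1 + b) / (1 - b)\<close> as \<open>a\<close> tends to \<open>0\<close>, so the square of
  \<open>\<theta> = Arccos w\<close> is asymptotic to \<open>- 4 \<i> a t (1 + b) / (1 - b)\<close>.  The intensity
  \<open>\<lambda> = \<sigma> / a\<^bsup>\<gamma>/2\<^esup>\<close> is chosen so that \<open>\<lambda> \<theta>\<^sup>\<gamma> = \<sigma> (\<theta>\<^sup>2 / a)\<^bsup>\<gamma>/2\<^esup>\<close> has the finite limit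
  \<open>\<sigma> (- 4 \<i> t (1 + b) / (1 - b))\<^bsup>\<gamma>/2\<^esup>\<close>, which is the stable exponent; this is \<open>arccos_pgf_limit\<close>
  together with \<open>stable_exponent\<close>.

  For this to speak about the random variables, the formula for the generating function on
  \<open>[0, 1)\<close> has to be continued to the unit circle.  The Moebius map sends the half plane
  \<open>Re z < 1\<close> into the unit disc, where the principal branches are holomorphic, so the identity
  theorem and radial limits apply (\<open>pgf_eq_arccos_pgf\<close>).

  The limit of the characteristic functions is the characteristic function of some law because
  the family is tight along sequences: the variables are nonnegative, and the same asymptotics
  at real arguments \<open>exp (- a s)\<close> show that their Laplace transforms converge to a function that
  tends to \<open>1\<close> at \<open>0\<close> (\<open>limit_law_of_laplace_convergence\<close>).  Stability of the limit law is the
  homogeneity of its exponent, translated by \<open>stable_distribution_of_char\<close>.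
\<close>

section \<open>Probability generating functions in the closed unit disc\<close>

text \<open>
  The partial sums are the expectations of \<open>z ^ X\<close> truncated to \<open>X < N\<close>, so dominated
  convergence gives the series on the whole closed disc, boundary included.
\<close>

lemma (in prob_space) pgf_sums:
  fixes X :: "'a \<Rightarrow> nat" and z :: complex
  assumes X [measurable]: "X \<in> M \<rightarrow>\<^sub>M count_space UNIV" and z: "norm z \<le> 1"
  shows "(\<lambda>n. of_real (prob {\<omega> \<in> space M. X \<omega> = n}) * z ^ n) sums pgf M X z"
  unfolding sums_def
proof -
  let ?s = "\<lambda>N \<omega>. if X \<omega> < N then z ^ X \<omega> else 0"
  have "(\<lambda>N. CLINT \<omega>|M. ?s N \<omega>) \<longlonglongrightarrow> (CLINT \<omega>|M. z ^ X \<omega>)"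
  proof (rule integral_dominated_convergence[where w="\<lambda>_. 1"])
    show "AE \<omega> in M. (\<lambda>N. ?s N \<omega>) \<longlonglongrightarrow> z ^ X \<omega>"
    proof (rule AE_I2)
      fix \<omega>
      have "eventually (\<lambda>N. ?s N \<omega> = z ^ X \<omega>) sequentially"
        using eventually_gt_at_top[of "X \<omega>"] by eventually_elim simp
      then show "(\<lambda>N. ?s N \<omega>) \<longlonglongrightarrow> z ^ X \<omega>" by (rule tendsto_eventually)
    qed
  qed (use z in \<open>auto simp: norm_power power_le_one\<close>)
  moreover have "(CLINT \<omega>|M. ?s N \<omega>) = (\<Sum>n<N. of_real (prob {\<omega> \<in> space M. X \<omega> = n}) * z ^ n)" for N
  proof -
    have "(CLINT \<omega>|M. ?s N \<omega>) =
        (CLINT \<omega>|M. (\<Sum>n<N. indicator {\<omega> \<in> space M. X \<omega> = n} \<omega> *\<^sub>R z ^ n))"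
    proof (rule Bochner_Integration.integral_cong[OF refl])
      fix \<omega> assume "\<omega> \<in> space M"
      then have "(\<Sum>n<N. indicat_real {\<omega> \<in> space M. X \<omega> = n} \<omega> *\<^sub>R z ^ n) =
          (\<Sum>n<N. if n = X \<omega> then z ^ n else 0)"
        by (intro sum.cong) (auto simp: indicator_def)
      then show "?s N \<omega> = (\<Sum>n<N. indicat_real {\<omega> \<in> space M. X \<omega> = n} \<omega> *\<^sub>R z ^ n)" by simp
    qed
    also have "\<dots> = (\<Sum>n<N. CLINT \<omega>|M. indicator {\<omega> \<in> space M. X \<omega> = n} \<omega> *\<^sub>R z ^ n)"
      by (intro Bochner_Integration.integral_sum integrable_scaleR_left) (auto simp: emeasure_eq_measure)
    also have "\<dots> = (\<Sum>n<N. of_real (prob {\<omega> \<in> space M. X \<omega> = n}) * z ^ n)"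
      by (intro sum.cong refl) (simp add: scaleR_conv_of_real)
    finally show ?thesis .
  qed
  ultimately show "(\<lambda>N. \<Sum>n<N. of_real (prob {\<omega> \<in> space M. X \<omega> = n}) * z ^ n) \<longlonglongrightarrow> pgf M X z"
    by (simp add: pgf_def)
qed

lemma (in prob_space) pgf_holomorphic:
  fixes X :: "'a \<Rightarrow> nat"
  assumes "X \<in> M \<rightarrow>\<^sub>M count_space UNIV"
  shows "pgf M X holomorphic_on ball 0 1"
proof (rule power_series_holomorphic)
  fix w :: complex assume "w \<in> ball 0 1"
  then show "(\<lambda>n. of_real (prob {\<omega> \<in> space M. X \<omega> = n}) * (w - 0) ^ n) sums pgf M X w"
    using pgf_sums[OF assms, of w] by simp
qed

lemma (in prob_space) pgf_tendsto_closed_disc: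
  fixes X :: "'a \<Rightarrow> nat"
  assumes [measurable]: "X \<in> M \<rightarrow>\<^sub>M count_space UNIV"
    and "\<And>k. norm (\<zeta> k) \<le> 1" and "\<zeta> \<longlonglongrightarrow> z"
  shows "(\<lambda>k. pgf M X (\<zeta> k)) \<longlonglongrightarrow> pgf M X z"
  unfolding pgf_def
  by (rule integral_dominated_convergence[where w="\<lambda>_. 1"])
     (use assms in \<open>auto simp: norm_power power_le_one intro!: AE_I2 tendsto_power\<close>)

lemma (in prob_space) pgf_1: "pgf M X 1 = 1"
  by (simp add: pgf_def prob_space)

section \<open>The Moebius map and the principal branch of the arccosine\<close>

definition mobius :: "real \<Rightarrow> complex \<Rightarrow> complex" where
  "mobius b z = ((1 + of_real b) * z - 2 * of_real b) / (2 - (1 + of_real b) * z)"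

lemma arccos_pgf_mobius:
  "arccos_pgf \<gamma> b l z = exp (- (of_real l * Arccos (mobius b z) powr of_real \<gamma>))"
  by (simp add: arccos_pgf_def mobius_def)

lemma mobius_denominator_nonzero:
  assumes "-1 < b" "b < 1" "Re z \<le> 1"
  shows "2 - (1 + of_real b) * z \<noteq> 0"
proof -
  have "(1 + b) * Re z \<le> (1 + b) * 1"
    using assms by (intro mult_left_mono) auto
  then have "Re (2 - (1 + of_real b) * z) > 0"
    using assms(2) by simp
  then show ?thesis by fastforce
qed

lemma one_minus_mobius:
  assumes "-1 < b" "b < 1" "Re z \<le> 1"
  shows "1 - mobius b z = 2 * (1 + of_real b) * (1 - z) / (2 - (1 + of_real b) * z)"
  using mobius_denominator_nonzero[OF assms] by (simp add: mobius_def field_simps)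

text \<open>
  The half plane \<open>Re z < 1\<close> is the natural domain: it is an open set containing the closed unit
  disc except \<open>1\<close>, and the Moebius map still sends it into the unit disc.  Hence both the
  holomorphy used inside the disc and the continuity used on its boundary can be read off there.
\<close>

lemma norm_mobius_less_1:
  assumes "-1 < b" "b < 1" "Re z < 1"
  shows "norm (mobius b z) < 1"
proof -
  let ?N = "(1 + of_real b) * z - 2 * of_real b" and ?D = "2 - (1 + of_real b) * z"
  \<comment> \<open>The terms in \<open>(norm z)\<^sup>2\<close> cancel, since \<open>z\<close> has the coefficients \<open>1 + b\<close> and
      \<open>- (1 + b)\<close> in numerator and denominator.\<close>
  have "(norm ?D)\<^sup>2 - (norm ?N)\<^sup>2 = 4 * ((1 - b) * (1 + b) * (1 - Re z))"
    unfolding cmod_power2 by (simp add: power2_eq_square) (simp add: algebra_simps)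
  also have "\<dots> > 0" using assms by simp
  finally have "norm ?N < norm ?D"
    by (simp add: power_less_imp_less_base)
  moreover have "norm ?D > 0"
    using mobius_denominator_nonzero[of b z] assms by simp
  ultimately show ?thesis by (simp add: mobius_def norm_divide)
qed

lemma abs_Re_mobius_less_1:
  assumes "-1 < b" "b < 1" "Re z < 1"
  shows "\<bar>Re (mobius b z)\<bar> < 1"
  using norm_mobius_less_1[OF assms] abs_Re_le_cmod[of "mobius b z"] by simp

text \<open>
  On the disc \<^const>\<open>Arccos\<close> has positive real part, so the power is also taken away from its
  branch cut.
\<close>

lemma arccos_pgf_holomorphic:
  assumes b: "-1 < b" "b < 1"
  shows "arccos_pgf \<gamma> b l holomorphic_on {z. Re z < 1}"
proof -
  have mob: "mobius b holomorphic_on {z. Re z < 1}"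
    unfolding mobius_def
    using mobius_denominator_nonzero[OF b] by (intro holomorphic_intros) auto
  have "(Arccos \<circ> mobius b) holomorphic_on {z. Re z < 1}"
    by (rule holomorphic_on_compose[OF mob holomorphic_on_Arccos])
       (use abs_Re_mobius_less_1[OF b] in auto)
  then have A: "(\<lambda>z. Arccos (mobius b z)) holomorphic_on {z. Re z < 1}"
    by (simp add: o_def)
  have "Arccos (mobius b z) \<notin> \<real>\<^sub>\<le>\<^sub>0" if "Re z < 1" for z
    using Arccos_bounds[OF abs_Re_mobius_less_1[OF b that]] by (auto simp: complex_nonpos_Reals_iff)
  then have "(\<lambda>z. exp (- (of_real l * Arccos (mobius b z) powr of_real \<gamma>))) holomorphic_on {z. Re z < 1}"
    by (intro holomorphic_intros A) auto
  then show ?thesis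
    by (simp add: arccos_pgf_mobius[abs_def])
qed

lemma Re_less_1_of_closed_disc:
  assumes "norm z \<le> 1" "z \<noteq> 1"
  shows "Re z < 1"
proof (rule ccontr)
  assume "\<not> Re z < 1"
  then have "Re z = 1" using complex_Re_le_cmod[of z] assms(1) by simp
  moreover from this have "Im z = 0"
    using assms(1) power_mono[OF assms(1), of 2] by (simp add: cmod_power2)
  ultimately show False using assms(2) by (simp add: complex_eq_iff)
qed

text \<open>
  The hypothesis concerns real arguments only.  The identity theorem carries it to the open
  disc, where both sides are holomorphic, and radial limits carry it to the boundary.  At
  \<open>z = 1\<close>, where the right-hand side has a branch point, both sides are evaluated directly.
\<close>

lemma (in prob_space) pgf_eq_arccos_pgf:
  fixes X :: "'a \<Rightarrow> nat"
  assumes b: "-1 < b" "b < 1"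
    and X: "X \<in> M \<rightarrow>\<^sub>M count_space UNIV"
    and eq: "\<And>x. 0 \<le> x \<Longrightarrow> x < 1 \<Longrightarrow> pgf M X (of_real x) = arccos_pgf \<gamma> b l (of_real x)"
    and z: "norm z \<le> 1"
  shows "pgf M X z = arccos_pgf \<gamma> b l z"
proof -
  have open_disc: "pgf M X w = arccos_pgf \<gamma> b l w" if w: "norm w < 1" for w
  proof -
    have "(\<lambda>w. pgf M X w - arccos_pgf \<gamma> b l w) holomorphic_on ball 0 1"
    proof (intro holomorphic_on_diff pgf_holomorphic[OF X])
      have "ball 0 1 \<subseteq> {z. Re z < 1}"
        by (auto intro: le_less_trans[OF complex_Re_le_cmod])
      then show "arccos_pgf \<gamma> b l holomorphic_on ball 0 1"
        by (rule holomorphic_on_subset[OF arccos_pgf_holomorphic[OF b]])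
    qed
    moreover have "(0::complex) islimpt of_real ` {0..<1::real}"
      unfolding islimpt_approachable
    proof (intro allI impI)
      fix e :: real assume "e > 0"
      then show "\<exists>x'\<in>complex_of_real ` {0..<1}. x' \<noteq> 0 \<and> dist x' 0 < e"
        by (intro bexI[of _ "of_real (min (e/2) (1/2))"]) auto
    qed
    moreover have "of_real ` {0..<1::real} \<subseteq> (ball 0 1 :: complex set)"
      by auto
    ultimately have "pgf M X w - arccos_pgf \<gamma> b l w = 0"
      by - (rule analytic_continuation[where f = "\<lambda>w. pgf M X w - arccos_pgf \<gamma> b l w"
            and S = "ball 0 1" and U = "of_real ` {0..<1}" and \<xi> = 0],
          use eq w in auto)
    then show ?thesis by simp
  qed
  show ?thesis
  proof (cases "z = 1")
    case True
    have "mobius b 1 = 1"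
      using one_minus_mobius[of b 1] b by simp
    then show ?thesis
      by (simp add: True pgf_1 arccos_pgf_mobius)
  next
    case False
    define \<zeta> where "\<zeta> k = of_real (1 - inverse (real (Suc k))) * z" for k
    have le: "\<bar>1 - inverse (real (Suc k))\<bar> < 1" for k
      by (simp add: field_simps)
    have norm_lt: "norm (\<zeta> k) < 1" for k
    proof -
      have "norm (\<zeta> k) = \<bar>1 - inverse (real (Suc k))\<bar> * norm z"
        unfolding \<zeta>_def norm_mult norm_of_real ..
      also have "\<dots> \<le> \<bar>1 - inverse (real (Suc k))\<bar> * 1"
        by (intro mult_left_mono z) auto
      finally show ?thesis using le[of k] by simp
    qed
    have "(\<lambda>k. of_real (1 - inverse (real (Suc k))) * z) \<longlonglongrightarrow> of_real (1 - 0) * z"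
      by (intro tendsto_intros LIMSEQ_inverse_real_of_nat)
    then have lim: "\<zeta> \<longlonglongrightarrow> z" by (simp add: \<zeta>_def[abs_def])
    have "isCont (arccos_pgf \<gamma> b l) z"
    proof (rule continuous_on_interior)
      show "continuous_on {z. Re z < 1} (arccos_pgf \<gamma> b l)"
        by (rule holomorphic_on_imp_continuous_on[OF arccos_pgf_holomorphic[OF b]])
      show "z \<in> interior {z. Re z < 1}"
        using Re_less_1_of_closed_disc[OF z False]
        by (simp add: interior_open open_halfspace_Re_lt)
    qed
    then have "(\<lambda>k. arccos_pgf \<gamma> b l (\<zeta> k)) \<longlonglongrightarrow> arccos_pgf \<gamma> b l z"
      using lim by (rule isCont_tendsto_compose)
    moreover have "(\<lambda>k. pgf M X (\<zeta> k)) \<longlonglongrightarrow> pgf M X z"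
      using norm_lt by (intro pgf_tendsto_closed_disc[OF X _ lim]) (simp add: less_imp_le)
    ultimately show ?thesis
      using open_disc[OF norm_lt] by (simp add: LIMSEQ_unique)
  qed
qed

section \<open>The local behaviour of the exponent at one\<close>

text \<open>
  Although \<open>1\<close> is a branch point, no choice of branch of the square root matters in the limit,
  as the root itself tends to \<open>0\<close>.
\<close>

lemma isCont_Arccos_1: "isCont Arccos 1"
proof -
  have "((\<lambda>z::complex. norm (csqrt (1 - z\<^sup>2))) \<longlongrightarrow> sqrt (norm (1 - (1::complex)\<^sup>2))) (at 1)"
    unfolding norm_csqrt by (intro tendsto_intros)
  then have *: "((\<lambda>z::complex. csqrt (1 - z\<^sup>2)) \<longlongrightarrow> 0) (at 1)"
    by (auto intro: tendsto_norm_zero_cancel)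
  have "((\<lambda>z. -\<i> * Ln (z + \<i> * csqrt (1 - z\<^sup>2))) \<longlongrightarrow> -\<i> * Ln (1 + \<i> * 0)) (at 1)"
    by (intro tendsto_intros * tendsto_Ln) auto
  then show ?thesis by (simp add: isCont_def Arccos_def)
qed

text \<open>
  With \<open>\<theta> = Arccos w\<close> one has \<open>1 - w = 1 - cos \<theta> = 2 sin\<^sup>2(\<theta>/2)\<close>, which is \<open>\<theta>\<^sup>2/2\<close> to leading
  order.
\<close>

lemma Arccos_squared_over_one_minus:
  "((\<lambda>w. (Arccos w)\<^sup>2 / (1 - w)) \<longlongrightarrow> 2) (at 1)"
proof -
  have "((\<lambda>h::complex. sin h / h) \<longlongrightarrow> 1) (at 0)"
    using DERIV_sin[of "0::complex"] by (simp add: DERIV_def)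
  then have "((\<lambda>h::complex. 2 * (inverse (sin h / h))\<^sup>2) \<longlongrightarrow> 2 * (inverse 1)\<^sup>2) (at 0)"
    by (intro tendsto_intros) auto
  moreover have "filterlim (\<lambda>w. Arccos w / 2) (at 0) (at 1)"
  proof (rule filterlim_atI)
    show "((\<lambda>w. Arccos w / 2) \<longlongrightarrow> 0) (at 1)"
      using tendsto_divide[OF isCont_Arccos_1[unfolded isCont_def] tendsto_const[of 2]] by simp
    have "Arccos w / 2 \<noteq> 0" if "w \<noteq> 1" for w
      using that cos_Arccos[of w] by (metis cos_zero div_by_1 divide_eq_0_iff zero_neq_numeral)
    then show "eventually (\<lambda>w. Arccos w / 2 \<noteq> 0) (at 1)"
      by (simp add: eventually_at_filter)
  qed
  ultimately have "((\<lambda>w. 2 * (inverse (sin (Arccos w / 2) / (Arccos w / 2)))\<^sup>2) \<longlongrightarrow> 2 * (inverse 1)\<^sup>2) (at 1)"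
    by (rule filterlim_compose)
  moreover have "2 * (inverse (sin (Arccos w / 2) / (Arccos w / 2)))\<^sup>2 = (Arccos w)\<^sup>2 / (1 - w)" for w
  proof -
    have "w = 1 - 2 * (sin (Arccos w / 2))\<^sup>2"
      using cos_double_sin[of "Arccos w / 2"] by simp
    then have "1 - w = 2 * (sin (Arccos w / 2))\<^sup>2"
      by (metis diff_diff_eq2 add_diff_cancel_left')
    then show ?thesis by (simp add: field_simps power2_eq_square)
  qed
  ultimately show ?thesis by simp
qed

text \<open>
  A right half-plane argument can be squared inside the principal power without crossing the
  cut.  This turns the exponent \<open>\<lambda> \<theta>\<^sup>\<gamma>\<close> with \<open>\<lambda> = \<sigma> / a\<^bsup>\<gamma>/2\<^esup>\<close> into a continuous function of
  \<open>\<theta>\<^sup>2 / a\<close>, the quantity that converges.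
\<close>

lemma powr_square_over_real:
  fixes \<theta> :: complex
  assumes "0 < Re \<theta>" "0 < a"
  shows "(\<theta>\<^sup>2 / of_real a) powr of_real (\<gamma> / 2) = \<theta> powr of_real \<gamma> / of_real (a powr (\<gamma> / 2))"
proof -
  have nz: "\<theta> \<noteq> 0" using assms by auto
  have "exp (2 * Ln \<theta> - of_real (ln a)) = \<theta>\<^sup>2 / of_real a"
    using nz assms(2) by (simp add: exp_diff exp_double exp_of_real)
  moreover have "\<bar>Im (Ln \<theta>)\<bar> < pi / 2"
    by (rule Re_Ln_pos_lt_imp[OF assms(1)])
  ultimately have "Ln (\<theta>\<^sup>2 / of_real a) = 2 * Ln \<theta> - of_real (ln a)"
    by (intro Ln_unique) auto
  moreover have "\<theta>\<^sup>2 / of_real a \<noteq> 0" using nz assms(2) by simp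
  ultimately have "(\<theta>\<^sup>2 / of_real a) powr of_real (\<gamma> / 2) =
      exp (of_real (\<gamma> / 2) * (2 * Ln \<theta> - of_real (ln a)))"
    unfolding powr_def by (simp only: if_False)
  also have "\<dots> = exp (of_real \<gamma> * Ln \<theta> - of_real (\<gamma> / 2 * ln a))"
    by (simp add: algebra_simps)
  also have "\<dots> = \<theta> powr of_real \<gamma> / of_real (a powr (\<gamma> / 2))"
    using nz assms(2) by (simp only: exp_diff exp_of_real) (simp add: powr_def)
  finally show ?thesis .
qed

text \<open>
  The limit is the derivative at \<open>0\<close>: the Moebius map has slope \<open>2 (1 + b) / (1 - b)\<close> at its fixed
  point \<open>1\<close>.
\<close>

lemma one_minus_mobius_exp_limit:
  assumes b: "-1 < b" "b < 1" and \<zeta>: "0 \<le> Re \<zeta>"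
  shows "((\<lambda>a. (1 - mobius b (exp (- (of_real a * \<zeta>)))) / of_real a)
    \<longlongrightarrow> 2 * of_real ((1 + b) / (1 - b)) * \<zeta>) (at_right 0)"
proof -
  let ?z = "\<lambda>a::real. exp (- (of_real a * \<zeta>))"
  have "((\<lambda>h. exp (- (h * \<zeta>))) has_field_derivative - \<zeta>) (at 0)"
    by (auto intro!: derivative_eq_intros)
  then have "((\<lambda>h. (exp (- (h * \<zeta>)) - 1) / h) \<longlongrightarrow> - \<zeta>) (at 0)"
    by (simp add: DERIV_def)
  moreover have "filterlim complex_of_real (at 0) (at_right 0)"
    by (rule filterlim_atI) (auto intro!: tendsto_eq_intros simp: eventually_at_filter)
  ultimately have "((\<lambda>a. (?z a - 1) / of_real a) \<longlongrightarrow> - \<zeta>) (at_right 0)"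
    by (rule filterlim_compose)
  then have "((\<lambda>a. - ((?z a - 1) / of_real a)) \<longlongrightarrow> - (- \<zeta>)) (at_right 0)"
    by (rule tendsto_minus)
  then have diff: "((\<lambda>a. (1 - ?z a) / of_real a) \<longlongrightarrow> \<zeta>) (at_right 0)"
    by (simp add: minus_divide_left)
  have z1: "(?z \<longlongrightarrow> 1) (at_right 0)"
    by (auto intro!: tendsto_eq_intros)
  have nz: "2 - (1 + of_real b) * 1 \<noteq> (0::complex)"
    using mobius_denominator_nonzero[OF b, of 1] by simp
  have "((\<lambda>a. 2 * (1 + of_real b) * ((1 - ?z a) / of_real a) / (2 - (1 + of_real b) * ?z a))
      \<longlongrightarrow> 2 * (1 + of_real b) * \<zeta> / (2 - (1 + of_real b) * 1)) (at_right 0)"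
    by (intro tendsto_intros diff z1 nz)
  also have "2 * (1 + of_real b) * \<zeta> / (2 - (1 + of_real b) * 1) = 2 * of_real ((1 + b) / (1 - b)) * \<zeta>"
    by simp
  finally have "((\<lambda>a. 2 * (1 + of_real b) * ((1 - ?z a) / of_real a) / (2 - (1 + of_real b) * ?z a))
      \<longlongrightarrow> 2 * of_real ((1 + b) / (1 - b)) * \<zeta>) (at_right 0)" .
  moreover have "eventually (\<lambda>a. 2 * (1 + of_real b) * ((1 - ?z a) / of_real a) / (2 - (1 + of_real b) * ?z a)
      = (1 - mobius b (?z a)) / of_real a) (at_right 0)"
    using eventually_at_right_less[of "0::real"]
  proof eventually_elim
    case (elim a)
    have "norm (?z a) \<le> 1" using elim \<zeta> by simp
    then have "Re (?z a) \<le> 1" using complex_Re_le_cmod order_trans by blast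
    then show ?case by (subst one_minus_mobius[OF b]) (auto simp: field_simps)
  qed
  ultimately show ?thesis by (rule Lim_transform_eventually)
qed

text \<open>
  The complex parameter \<open>\<zeta>\<close> serves two purposes: \<open>\<zeta> = - \<i> t\<close> gives the limit of the characteristic
  functions, and real \<open>\<zeta> > 0\<close> gives the limit of the Laplace transforms, from which tightness
  follows.  The conditions on \<open>\<zeta>\<close> keep \<open>exp (- a \<zeta>)\<close> in the closed unit disc and the limit of
  \<open>\<theta>\<^sup>2 / a\<close> off the cut of the power.
\<close>

lemma arccos_pgf_limit:
  assumes b: "-1 < b" "b < 1" and \<zeta>: "0 \<le> Re \<zeta>" "\<zeta> \<noteq> 0"
  shows "((\<lambda>a. arccos_pgf \<gamma> b (\<sigma> / a powr (\<gamma> / 2)) (exp (- (of_real a * \<zeta>))))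
    \<longlongrightarrow> exp (- (of_real \<sigma> * (of_real (4 * ((1 + b) / (1 - b))) * \<zeta>) powr of_real (\<gamma> / 2)))) (at_right 0)"
proof -
  define c where "c = (1 + b) / (1 - b)"
  have c: "c > 0" using b by (simp add: c_def)
  let ?w = "\<lambda>a. mobius b (exp (- (of_real a * \<zeta>)))"
  have quot: "((\<lambda>a. (1 - ?w a) / of_real a) \<longlongrightarrow> 2 * of_real c * \<zeta>) (at_right 0)"
    using one_minus_mobius_exp_limit[OF b \<zeta>(1)] by (simp add: c_def)
  have nz: "2 * of_real c * \<zeta> \<noteq> 0" using c \<zeta> by simp
  have ne: "eventually (\<lambda>a. ?w a \<noteq> 1) (at_right 0)"
    using tendsto_imp_eventually_ne[OF quot nz] by eventually_elim auto
  have pos: "eventually (\<lambda>a::real. 0 < a) (at_right 0)"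
    by (rule eventually_at_right_less)
  have "((\<lambda>a. 1 - of_real a * ((1 - ?w a) / of_real a)) \<longlongrightarrow> 1 - of_real 0 * (2 * of_real c * \<zeta>)) (at_right 0)"
    by (intro tendsto_intros quot)
  moreover have "eventually (\<lambda>a. 1 - of_real a * ((1 - ?w a) / of_real a) = ?w a) (at_right 0)"
    using pos by eventually_elim simp
  ultimately have "(?w \<longlongrightarrow> 1) (at_right 0)"
    by (simp add: tendsto_cong)
  then have w_at: "filterlim ?w (at 1) (at_right 0)"
    using ne by (rule filterlim_atI)
  have "((\<lambda>a. (Arccos (?w a))\<^sup>2 / (1 - ?w a) * ((1 - ?w a) / of_real a)) \<longlongrightarrow> 2 * (2 * of_real c * \<zeta>)) (at_right 0)"
    by (intro tendsto_mult quot filterlim_compose[OF Arccos_squared_over_one_minus w_at])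
  also have "2 * (2 * of_real c * \<zeta>) = of_real (4 * c) * \<zeta>" by simp
  finally have "((\<lambda>a. (Arccos (?w a))\<^sup>2 / (1 - ?w a) * ((1 - ?w a) / of_real a)) \<longlongrightarrow> of_real (4 * c) * \<zeta>) (at_right 0)" .
  moreover have "eventually (\<lambda>a. (Arccos (?w a))\<^sup>2 / (1 - ?w a) * ((1 - ?w a) / of_real a)
      = (Arccos (?w a))\<^sup>2 / of_real a) (at_right 0)"
    using ne by eventually_elim simp
  ultimately have sq: "((\<lambda>a. (Arccos (?w a))\<^sup>2 / of_real a) \<longlongrightarrow> of_real (4 * c) * \<zeta>) (at_right 0)"
    by (rule Lim_transform_eventually)
  have "of_real (4 * c) * \<zeta> \<notin> \<real>\<^sub>\<le>\<^sub>0"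
  proof
    assume "of_real (4 * c) * \<zeta> \<in> \<real>\<^sub>\<le>\<^sub>0"
    then have "Im \<zeta> = 0" "Re \<zeta> \<le> 0"
      using c by (auto simp: complex_nonpos_Reals_iff mult_le_0_iff)
    then show False using \<zeta> by (simp add: complex_eq_iff)
  qed
  then have "((\<lambda>a. exp (- (of_real \<sigma> * ((Arccos (?w a))\<^sup>2 / of_real a) powr of_real (\<gamma> / 2))))
      \<longlongrightarrow> exp (- (of_real \<sigma> * (of_real (4 * c) * \<zeta>) powr of_real (\<gamma> / 2)))) (at_right 0)"
    by (intro tendsto_exp tendsto_minus tendsto_mult tendsto_const tendsto_powr_complex sq)
  moreover have "eventually (\<lambda>a. exp (- (of_real \<sigma> * ((Arccos (?w a))\<^sup>2 / of_real a) powr of_real (\<gamma> / 2)))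
      = arccos_pgf \<gamma> b (\<sigma> / a powr (\<gamma> / 2)) (exp (- (of_real a * \<zeta>)))) (at_right 0)"
    using pos ne
  proof eventually_elim
    case (elim a)
    let ?z = "exp (- (of_real a * \<zeta>))"
    have "?z \<noteq> 1"
      using elim(2) one_minus_mobius[OF b, of ?z] by auto
    moreover have "norm ?z \<le> 1" using elim \<zeta> by simp
    ultimately have "Re ?z < 1" by (intro Re_less_1_of_closed_disc)
    then have "0 < Re (Arccos (?w a))"
      using Arccos_bounds[OF abs_Re_mobius_less_1[OF b]] by blast
    then show ?case
      using elim(1) by (simp add: powr_square_over_real[of "Arccos (?w a)" a \<gamma>, simplified] arccos_pgf_mobius)
  qed
  ultimately show ?thesis
    unfolding c_def by (rule Lim_transform_eventually)
qed

section \<open>Tightness and limit laws from Laplace transforms\<close>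

text \<open>
  Integrated form of the bound of \<open>exp (- s x)\<close> by \<open>1\<close> for \<open>x \<le> 1/s\<close> and by \<open>exp (- 1)\<close> beyond:
  a Laplace transform close to \<open>1\<close> at \<open>s\<close> leaves little mass above \<open>1/s\<close>.
\<close>

lemma (in real_distribution) laplace_le_cdf:
  assumes nonneg: "AE x in M. 0 \<le> x" and s: "0 < s"
  shows "expectation (\<lambda>x. exp (- (s * x))) \<le> exp (- 1) + (1 - exp (- 1)) * cdf M (1 / s)"
proof -
  have int: "integrable M (\<lambda>x. exp (- (s * x)))"
    using nonneg s by (intro integrable_const_bound[of _ 1]) (auto elim!: eventually_mono)
  have "expectation (\<lambda>x. exp (- (s * x))) \<le>
      expectation (\<lambda>x. exp (- 1) + (1 - exp (- 1)) * indicator {..1 / s} x)"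
  proof (rule integral_mono_AE[OF int])
    show "integrable M (\<lambda>x. exp (- 1) + (1 - exp (- 1)) * indicator {..1 / s} x :: real)"
      by (intro Bochner_Integration.integrable_add integrable_mult_right) (auto simp: emeasure_eq_measure)
    show "AE x in M. exp (- (s * x)) \<le> exp (- 1) + (1 - exp (- 1)) * indicator {..1 / s} x"
      using nonneg
    proof eventually_elim
      case (elim x)
      show ?case
      proof (cases "x \<le> 1 / s")
        case True
        then show ?thesis using elim s by simp
      next
        case False
        then have "1 \<le> s * x" using s by (simp add: field_simps)
        then show ?thesis using False by simp
      qed
    qed
  qed
  also have "\<dots> = exp (- 1) + (1 - exp (- 1)) * cdf M (1 / s)"
    by (subst Bochner_Integration.integral_add) (auto simp: emeasure_eq_measure cdf_def prob_space[unfolded space_eq_univ])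
  finally show ?thesis .
qed

text \<open>
  One small \<open>s\<close> controls the tails of all but finitely many of the laws, because the transforms
  converge at \<open>s\<close>; each of the remaining laws is tight by itself.
\<close>

lemma tight_of_laplace_convergence:
  fixes \<mu> :: "nat \<Rightarrow> real measure" and L :: "real \<Rightarrow> real"
  assumes dist: "\<And>n. real_distribution (\<mu> n)"
    and nonneg: "\<And>n. AE x in \<mu> n. 0 \<le> x"
    and conv: "\<And>s. 0 < s \<Longrightarrow> (\<lambda>n. LINT x|\<mu> n. exp (- (s * x))) \<longlonglongrightarrow> L s"
    and L: "(L \<longlongrightarrow> 1) (at_right 0)"
  shows "tight \<mu>"
  unfolding tight_def
proof (intro conjI allI impI dist)
  fix \<epsilon> :: real assume \<epsilon>: "\<epsilon> > 0"
  have e1: "exp (- 1) < (1::real)" by simp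
  then have "1 - \<epsilon> * (1 - exp (- 1)) < 1" using \<epsilon> by simp
  then have "eventually (\<lambda>s. L s > 1 - \<epsilon> * (1 - exp (- 1)) \<and> 0 < s) (at_right 0)"
    by (intro eventually_conj order_tendstoD(1)[OF L] eventually_at_right_less)
  then obtain s where s: "L s > 1 - \<epsilon> * (1 - exp (- 1))" "0 < s"
    using eventually_happens'[OF trivial_limit_at_right_real] by blast
  obtain N where N: "\<And>n. N \<le> n \<Longrightarrow> (LINT x|\<mu> n. exp (- (s * x))) > 1 - \<epsilon> * (1 - exp (- 1))"
    using order_tendstoD(1)[OF conv[OF s(2)] s(1)] by (auto simp: eventually_sequentially)
  have tail: "cdf (\<mu> n) (1 / s) > 1 - \<epsilon>" if "N \<le> n" for n
  proof -
    have "1 - \<epsilon> * (1 - exp (- 1)) < exp (- 1) + (1 - exp (- 1)) * cdf (\<mu> n) (1 / s)"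
      using N[OF that] real_distribution.laplace_le_cdf[OF dist nonneg s(2), of n] by linarith
    then have "(1 - exp (- 1)) * (1 - \<epsilon>) < (1 - exp (- 1)) * cdf (\<mu> n) (1 / s)"
      by (simp add: algebra_simps)
    then show ?thesis using e1 by (simp del: exp_less_one_iff)
  qed
  have "\<forall>n\<in>{..<N}. eventually (\<lambda>K. cdf (\<mu> n) K > 1 - \<epsilon>) at_top"
  proof
    fix n
    show "eventually (\<lambda>K. cdf (\<mu> n) K > 1 - \<epsilon>) at_top"
      by (rule order_tendstoD(1)[OF real_distribution.cdf_lim_at_top_prob[OF dist]]) (use \<epsilon> in simp)
  qed
  then have "eventually (\<lambda>K. \<forall>n\<in>{..<N}. cdf (\<mu> n) K > 1 - \<epsilon>) at_top"
    by (rule eventually_ball_finite[OF finite_lessThan])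
  then have "eventually (\<lambda>K. (\<forall>n\<in>{..<N}. cdf (\<mu> n) K > 1 - \<epsilon>) \<and> max 0 (1 / s) \<le> K) at_top"
    by (rule eventually_conj[OF _ eventually_ge_at_top])
  then obtain K where K: "\<And>n. n < N \<Longrightarrow> cdf (\<mu> n) K > 1 - \<epsilon>" "0 \<le> K" "1 / s \<le> K"
    by (auto dest!: eventually_happens'[OF trivial_limit_at_top_linorder])
  show "\<exists>a b. a < b \<and> (\<forall>n. 1 - \<epsilon> < measure (\<mu> n) {a<..b})"
  proof (rule exI[of _ "-1"], rule exI[of _ K], intro conjI allI)
    show "-1 < K" using K(2) by simp
    fix n
    interpret real_distribution "\<mu> n" by (rule dist)
    have "1 - \<epsilon> < cdf (\<mu> n) K"
    proof (cases "n < N")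
      case False
      then show ?thesis
        using tail[of n] cdf_nondecreasing[OF K(3)] by simp
    qed (use K(1) in simp)
    moreover have "cdf (\<mu> n) (-1) = 0"
    proof -
      have "AE x in \<mu> n. x \<notin> {..-1}" using nonneg[of n] by eventually_elim auto
      then show ?thesis unfolding cdf_def by (subst prob_eq_0) auto
    qed
    ultimately show "1 - \<epsilon> < measure (\<mu> n) {-1<..K}"
      using cdf_diff_eq[of "-1" K] K(2) by simp
  qed
qed

text \<open>
  Convergence of characteristic functions alone does not provide a limit law.  Tightness and
  Helly selection produce one along a subsequence, and its characteristic function must be the
  pointwise limit.
\<close>

lemma limit_law_of_laplace_convergence:
  fixes \<mu> :: "nat \<Rightarrow> real measure" and L :: "real \<Rightarrow> real"
  assumes dist: "\<And>n. real_distribution (\<mu> n)"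
    and nonneg: "\<And>n. AE x in \<mu> n. 0 \<le> x"
    and conv: "\<And>s. 0 < s \<Longrightarrow> (\<lambda>n. LINT x|\<mu> n. exp (- (s * x))) \<longlonglongrightarrow> L s"
    and L: "(L \<longlongrightarrow> 1) (at_right 0)"
    and char: "\<And>t. (\<lambda>n. char (\<mu> n) t) \<longlonglongrightarrow> \<phi> t"
  obtains \<nu> where "real_distribution \<nu>" "\<And>t. char \<nu> t = \<phi> t"
proof -
  have "tight \<mu>" by (rule tight_of_laplace_convergence[OF dist nonneg conv L])
  from tight_imp_convergent_subsubsequence[OF this, of id]
  obtain r \<nu> where r: "strict_mono r" and \<nu>: "real_distribution \<nu>" "weak_conv_m (\<mu> \<circ> r) \<nu>"
    by (auto simp: strict_mono_id)
  have "char \<nu> t = \<phi> t" for t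
  proof (rule LIMSEQ_unique)
    show "(\<lambda>n. char ((\<mu> \<circ> r) n) t) \<longlonglongrightarrow> char \<nu> t"
      by (rule levy_continuity1) (use dist \<nu> in \<open>simp_all add: o_def\<close>)
    show "(\<lambda>n. char ((\<mu> \<circ> r) n) t) \<longlonglongrightarrow> \<phi> t"
      using LIMSEQ_subseq_LIMSEQ[OF char r] by (simp add: o_def)
  qed
  then show ?thesis using \<nu>(1) that by blast
qed

section \<open>Stability in terms of characteristic functions\<close>

lemma (in real_distribution) char_pair_linear_combination:
  "char (distr (M \<Otimes>\<^sub>M M) borel (\<lambda>(x, y). A * x + B * y)) t = char M (A * t) * char M (B * t)"
proof -
  interpret P: pair_prob_space M M ..
  have meas [measurable]: "(\<lambda>(x, y). A * x + B * y) \<in> borel_measurable (M \<Otimes>\<^sub>M M)"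
    by (simp add: split_beta')
  have "char (distr (M \<Otimes>\<^sub>M M) borel (\<lambda>(x, y). A * x + B * y)) t =
      (CLINT p|(M \<Otimes>\<^sub>M M). (\<lambda>(x, y). iexp (A * t * x) * iexp (B * t * y)) p)"
    unfolding char_def
    by (subst integral_distr) (auto simp: split_beta' exp_add[symmetric] algebra_simps intro!: Bochner_Integration.integral_cong)
  also have "\<dots> = (CLINT x|M. CLINT y|M. iexp (A * t * x) * iexp (B * t * y))"
    by (rule P.integral_fst[symmetric], rule P.P.integrable_const_bound[of _ 1])
       (auto simp: norm_mult)
  also have "\<dots> = char M (A * t) * char M (B * t)"
    by (simp add: char_def)
  finally show ?thesis .
qed

text \<open>
  By uniqueness of characteristic functions, stability with zero shift (strict stability) is a
  multiplicativity property.
\<close>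

lemma (in real_distribution) stable_distribution_of_char:
  assumes "0 < \<alpha>" "\<alpha> \<le> 2"
    and prod: "\<And>A B t. 0 < A \<Longrightarrow> 0 < B \<Longrightarrow>
      char M (A * t) * char M (B * t) = char M ((A powr \<alpha> + B powr \<alpha>) powr (1 / \<alpha>) * t)"
  shows "stable_distribution \<alpha> M"
  unfolding stable_distribution_def
proof (intro conjI assms(1,2) allI impI exI[of _ 0])
  show "real_distribution M" by unfold_locales
  fix A B :: real assume AB: "0 < A" "0 < B"
  let ?C = "(A powr \<alpha> + B powr \<alpha>) powr (1 / \<alpha>)"
  interpret P: pair_prob_space M M ..
  show "distr (M \<Otimes>\<^sub>M M) borel (\<lambda>(x, y). A * x + B * y) = distr M borel (\<lambda>x. ?C * x + 0)"
  proof (rule Levy_uniqueness)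
    show "real_distribution (distr (M \<Otimes>\<^sub>M M) borel (\<lambda>(x, y). A * x + B * y))"
      by (rule P.P.real_distribution_distr) (simp add: split_beta')
    show "real_distribution (distr M borel (\<lambda>x. ?C * x + 0))"
      by (rule real_distribution_distr) simp
    show "char (distr (M \<Otimes>\<^sub>M M) borel (\<lambda>(x, y). A * x + B * y)) = char (distr M borel (\<lambda>x. ?C * x + 0))"
    proof
      fix t
      have "char (distr M borel (\<lambda>x. ?C * x + 0)) t = char M (?C * t)"
        unfolding char_def by (subst integral_distr) (auto simp: mult_ac)
      then show "char (distr (M \<Otimes>\<^sub>M M) borel (\<lambda>(x, y). A * x + B * y)) t =
          char (distr M borel (\<lambda>x. ?C * x + 0)) t"
        by (simp add: char_pair_linear_combination prod[OF AB])
    qed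
  qed
qed

text \<open>
  Here \<open>- \<i> t = \<bar>t\<bar> exp (- \<i> sgn t \<pi>/2)\<close>, so the power turns the angle into \<open>- sgn t \<pi>\<gamma>/4\<close>, and
  \<open>4\<^bsup>\<gamma>/2\<^esup> = 2\<^sup>\<gamma>\<close>.
\<close>

lemma stable_exponent:
  fixes t c \<gamma> :: real
  assumes "0 < c" "t \<noteq> 0"
  shows "(of_real (4 * c) * (- \<i> * of_real t)) powr of_real (\<gamma> / 2) =
    of_real (2 powr \<gamma> * c powr (\<gamma> / 2) * \<bar>t\<bar> powr (\<gamma> / 2)) *
      (of_real (cos (pi * \<gamma> / 4)) - \<i> * of_real (sgn t * sin (pi * \<gamma> / 4)))"
proof -
  define r where "r = 4 * c * \<bar>t\<bar>"
  have r: "r > 0" using assms by (simp add: r_def)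
  have eq: "of_real (4 * c) * (- \<i> * of_real t) = of_real r * (- \<i> * of_real (sgn t))"
    by (simp add: r_def sgn_if)
  have "Ln (- \<i> * of_real (sgn t)) = - (\<i> * of_real (sgn t * (pi / 2)))"
    using assms(2) by (cases "t > 0") (auto simp: sgn_if)
  then have "Ln (of_real r * (- \<i> * of_real (sgn t))) = of_real (ln r) - \<i> * of_real (sgn t * (pi / 2))"
    using r assms(2) by (subst Ln_times_of_real) (auto simp: sgn_if Ln_of_real)
  then have "(of_real (4 * c) * (- \<i> * of_real t)) powr of_real (\<gamma> / 2) =
      exp (of_real (\<gamma> / 2) * (of_real (ln r) - \<i> * of_real (sgn t * (pi / 2))))"
    using r assms(2) unfolding eq powr_def by (simp add: sgn_eq_0_iff)
  also have "\<dots> = exp (of_real (\<gamma> / 2 * ln r) + \<i> * of_real (- (sgn t * (pi * \<gamma> / 4))))"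
    by (simp add: algebra_simps)
  also have "\<dots> = of_real (r powr (\<gamma> / 2)) * cis (- (sgn t * (pi * \<gamma> / 4)))"
    using r by (simp only: exp_add exp_of_real cis_conv_exp) (simp add: powr_def)
  also have "r powr (\<gamma> / 2) = 2 powr \<gamma> * c powr (\<gamma> / 2) * \<bar>t\<bar> powr (\<gamma> / 2)"
  proof -
    have "(4::real) powr (\<gamma> / 2) = 2 powr \<gamma>"
      using powr_powr[of "2::real" 2 "\<gamma> / 2"] by simp
    then show ?thesis using assms by (simp add: r_def powr_mult)
  qed
  also have "cis (- (sgn t * (pi * \<gamma> / 4))) =
      of_real (cos (pi * \<gamma> / 4)) - \<i> * of_real (sgn t * sin (pi * \<gamma> / 4))"
    using assms(2) by (auto simp: sgn_if complex_eq_iff)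
  finally show ?thesis .
qed

section \<open>Convergence to the stable law\<close>

lemma (in prob_space) char_scaled_eq_pgf:
  fixes X :: "'a \<Rightarrow> nat"
  assumes [measurable]: "X \<in> M \<rightarrow>\<^sub>M count_space UNIV"
  shows "char (distr M borel (\<lambda>\<omega>. a * real (X \<omega>))) t = pgf M X (exp (\<i> * of_real (a * t)))"
  unfolding char_def pgf_def
  by (subst integral_distr)
     (auto simp: exp_of_nat_mult[symmetric] mult_ac intro!: Bochner_Integration.integral_cong)

lemma (in prob_space) laplace_scaled_eq_pgf:
  fixes X :: "'a \<Rightarrow> nat"
  assumes [measurable]: "X \<in> M \<rightarrow>\<^sub>M count_space UNIV"
  shows "of_real (LINT x|distr M borel (\<lambda>\<omega>. a * real (X \<omega>)). exp (- (s * x))) =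
    pgf M X (exp (- (of_real a * of_real s)))"
proof -
  have "of_real (LINT x|distr M borel (\<lambda>\<omega>. a * real (X \<omega>)). exp (- (s * x))) =
      (CLINT \<omega>|M. of_real (exp (- (s * (a * real (X \<omega>))))))"
    by (subst integral_distr) auto
  also have "\<dots> = pgf M X (exp (- (of_real a * of_real s)))"
    unfolding pgf_def
    by (intro Bochner_Integration.integral_cong refl)
       (simp add: exp_of_nat_mult[symmetric] exp_of_real[symmetric] mult_ac)
  finally show ?thesis .
qed

theorem theorem6p4:
  fixes \<gamma> b \<sigma> :: real
    and M :: "real \<Rightarrow> 'w measure"
    and X :: "real \<Rightarrow> 'w \<Rightarrow> nat"
  assumes "0 < \<gamma>" and "\<gamma> \<le> 2"
    and "-1 < b" and "b < 1"
    and "0 < \<sigma>"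
    and "\<And>a. 0 < a \<Longrightarrow> prob_space (M a)"
    and "\<And>a. 0 < a \<Longrightarrow> X a \<in> M a \<rightarrow>\<^sub>M count_space UNIV"
    and "\<And>a z. 0 < a \<Longrightarrow> 0 \<le> z \<Longrightarrow> z < 1 \<Longrightarrow>
           pgf (M a) (X a) (of_real z) = arccos_pgf \<gamma> b (\<sigma> / a powr (\<gamma> / 2)) (of_real z)"
  shows "(\<forall>a>0. \<forall>t.
            char (distr (M a) borel (\<lambda>\<omega>. a * real (X a \<omega>))) t =
            arccos_pgf \<gamma> b (\<sigma> / a powr (\<gamma> / 2)) (exp (\<i> * of_real (a * t)))) \<and>
         (\<exists>\<mu>. stable_distribution (\<gamma> / 2) \<mu> \<and>
            (\<gamma> < 2 \<longrightarrow> (\<forall>x. \<mu> \<noteq> return borel x)) \<and>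
            (\<forall>t. char \<mu> t =
               exp (- (of_real (\<sigma> * 2 powr \<gamma> * ((1 + b) / (1 - b)) powr (\<gamma> / 2) * \<bar>t\<bar> powr (\<gamma> / 2)) *
                 (of_real (cos (pi * \<gamma> / 4)) - \<i> * of_real (sgn t * sin (pi * \<gamma> / 4)))))) \<and>
            (\<forall>t. ((\<lambda>a. char (distr (M a) borel (\<lambda>\<omega>. a * real (X a \<omega>))) t) \<longlongrightarrow> char \<mu> t)
                   (at_right 0)))"
proof -
  note \<gamma> = assms(1,2) and b = assms(3,4) and \<sigma> = assms(5)
    and prob = assms(6) and X = assms(7)
  define c where "c = (1 + b) / (1 - b)"
  have c: "c > 0" using b by (simp add: c_def)
  define K where "K = \<sigma> * 2 powr \<gamma> * c powr (\<gamma> / 2)"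
  have K: "K > 0" using \<sigma> c by (simp add: K_def)
  define \<phi> where "\<phi> t = exp (- (of_real (K * \<bar>t\<bar> powr (\<gamma> / 2)) *
    (of_real (cos (pi * \<gamma> / 4)) - \<i> * of_real (sgn t * sin (pi * \<gamma> / 4)))))" for t :: real
  let ?D = "\<lambda>a. distr (M a) borel (\<lambda>\<omega>. a * real (X a \<omega>))"
  let ?G = "\<lambda>a. arccos_pgf \<gamma> b (\<sigma> / a powr (\<gamma> / 2))"
  have rdist: "real_distribution (?D a)" if "a > 0" for a
  proof -
    interpret prob_space "M a" by (rule prob[OF that])
    have [measurable]: "X a \<in> M a \<rightarrow>\<^sub>M count_space UNIV" by (rule X[OF that])
    show ?thesis by (rule real_distribution_distr) measurable
  qed
  have nonneg: "AE x in ?D a. 0 \<le> x" if "a > 0" for a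
  proof -
    have [measurable]: "X a \<in> M a \<rightarrow>\<^sub>M count_space UNIV" by (rule X[OF that])
    show ?thesis using that by (subst AE_distr_iff) auto
  qed
  have pgf: "pgf (M a) (X a) z = ?G a z" if "a > 0" "norm z \<le> 1" for a z
    by (rule prob_space.pgf_eq_arccos_pgf[OF prob b X])
       (use that assms(8) in auto)
  have char: "char (?D a) t = ?G a (exp (\<i> * of_real (a * t)))" if "a > 0" for a t
    using prob_space.char_scaled_eq_pgf[OF prob X, OF that that, of a t] pgf[OF that] by simp
  have laplace: "of_real (LINT x|?D a. exp (- (s * x))) = ?G a (exp (- (of_real a * of_real s)))"
    if "a > 0" "s > 0" for a s
    using prob_space.laplace_scaled_eq_pgf[OF prob X, OF that(1) that(1), of a s]
      pgf[OF that(1), of "exp (- (of_real a * of_real s))"] that by simp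
  have pos: "eventually (\<lambda>a::real. 0 < a) (at_right 0)"
    by (rule eventually_at_right_less)
  have char_lim: "((\<lambda>a. char (?D a) t) \<longlongrightarrow> \<phi> t) (at_right 0)" for t
  proof (cases "t = 0")
    case True
    have "eventually (\<lambda>a. char (?D a) t = \<phi> t) (at_right 0)"
      using pos
    proof eventually_elim
      case (elim a)
      show ?case
        using real_distribution.char_zero[OF rdist[OF elim]] by (simp add: True \<phi>_def)
    qed
    then show ?thesis by (rule tendsto_eventually)
  next
    case False
    have "((\<lambda>a. ?G a (exp (- (of_real a * (- \<i> * of_real t))))) \<longlongrightarrow>
        exp (- (of_real \<sigma> * (of_real (4 * c) * (- \<i> * of_real t)) powr of_real (\<gamma> / 2)))) (at_right 0)"
      unfolding c_def using False by (intro arccos_pgf_limit b) auto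
    also have "exp (- (of_real \<sigma> * (of_real (4 * c) * (- \<i> * of_real t)) powr of_real (\<gamma> / 2))) = \<phi> t"
      unfolding stable_exponent[OF c False] by (simp add: \<phi>_def K_def mult_ac)
    finally have "((\<lambda>a. ?G a (exp (- (of_real a * (- \<i> * of_real t))))) \<longlongrightarrow> \<phi> t) (at_right 0)" .
    moreover have "eventually (\<lambda>a. ?G a (exp (- (of_real a * (- \<i> * of_real t)))) = char (?D a) t) (at_right 0)"
      using pos by eventually_elim (simp add: char mult_ac)
    ultimately show ?thesis by (rule Lim_transform_eventually)
  qed
  define L where "L s = exp (- (\<sigma> * (4 * c * s) powr (\<gamma> / 2)))" for s
  have laplace_lim: "((\<lambda>a. LINT x|?D a. exp (- (s * x))) \<longlongrightarrow> L s) (at_right 0)" if s: "s > 0" for s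
  proof -
    have "((\<lambda>a. ?G a (exp (- (of_real a * of_real s)))) \<longlongrightarrow>
        exp (- (of_real \<sigma> * (of_real (4 * c) * of_real s) powr of_real (\<gamma> / 2)))) (at_right 0)"
      unfolding c_def using s by (intro arccos_pgf_limit b) auto
    moreover have "(of_real (4 * c) * of_real s) powr of_real (\<gamma> / 2) = (of_real ((4 * c * s) powr (\<gamma> / 2)) :: complex)"
      using c s powr_of_real[of "4 * c * s" "\<gamma> / 2"] by simp
    ultimately have "((\<lambda>a. ?G a (exp (- (of_real a * of_real s)))) \<longlongrightarrow> of_real (L s)) (at_right 0)"
      by (simp only: L_def exp_of_real[symmetric] of_real_minus of_real_mult)
    moreover have "eventually (\<lambda>a. ?G a (exp (- (of_real a * of_real s))) =
        of_real (LINT x|?D a. exp (- (s * x)))) (at_right 0)"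
      using pos by eventually_elim (rule laplace[symmetric, OF _ s])
    ultimately have "((\<lambda>a. complex_of_real (LINT x|?D a. exp (- (s * x)))) \<longlongrightarrow> of_real (L s)) (at_right 0)"
      by (rule Lim_transform_eventually)
    then show ?thesis by (simp only: tendsto_of_real_iff)
  qed
  have L: "(L \<longlongrightarrow> 1) (at_right 0)"
  proof -
    have "((\<lambda>s. (4 * c * s) powr (\<gamma> / 2)) \<longlongrightarrow> (4 * c * 0) powr (\<gamma> / 2)) (at_right 0)"
      using \<gamma> c pos by (intro tendsto_powr' tendsto_intros) (auto elim!: eventually_mono)
    then have "((\<lambda>s. exp (- (\<sigma> * (4 * c * s) powr (\<gamma> / 2)))) \<longlongrightarrow> exp (- (\<sigma> * 0))) (at_right 0)"
      by (intro tendsto_intros) simp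
    then show ?thesis by (simp add: L_def[abs_def])
  qed
  \<comment> \<open>The limit law is extracted along one sequence \<open>a \<rightarrow> 0\<close>; convergence for all \<open>a\<close> is already known.\<close>
  have seq: "filterlim (\<lambda>n. inverse (real (Suc n))) (at_right 0) sequentially"
    by (intro tendsto_imp_filterlim_at_right LIMSEQ_inverse_real_of_nat) simp
  let ?\<mu> = "\<lambda>n. ?D (inverse (real (Suc n)))"
  obtain \<mu> where \<mu>: "real_distribution \<mu>" "\<And>t. char \<mu> t = \<phi> t"
  proof (rule limit_law_of_laplace_convergence[of ?\<mu> L \<phi>])
    show "real_distribution (?\<mu> n)" for n by (rule rdist) simp
    show "AE x in ?\<mu> n. 0 \<le> x" for n
      by (rule nonneg) simp
    show "(\<lambda>n. LINT x|?\<mu> n. exp (- (s * x))) \<longlonglongrightarrow> L s" if "0 < s" for s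
      by (rule filterlim_compose[OF laplace_lim[OF that] seq])
    show "(\<lambda>n. char (?\<mu> n) t) \<longlonglongrightarrow> \<phi> t" for t
      by (rule filterlim_compose[OF char_lim seq])
  qed (use L in auto)
  interpret \<mu>: real_distribution \<mu> by (rule \<mu>(1))
  \<comment> \<open>The exponent of \<open>\<phi>\<close> is homogeneous of degree \<open>\<gamma>/2\<close> under positive scaling.\<close>
  have "stable_distribution (\<gamma> / 2) \<mu>"
  proof (rule \<mu>.stable_distribution_of_char)
    fix A B t :: real assume AB: "0 < A" "0 < B"
    let ?S = "A powr (\<gamma> / 2) + B powr (\<gamma> / 2)"
    have S: "?S > 0" using AB by (simp add: add_pos_pos)
    have *: "\<phi> (u * t) = exp (of_real (u powr (\<gamma> / 2)) * - (of_real (K * \<bar>t\<bar> powr (\<gamma> / 2)) *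
      (of_real (cos (pi * \<gamma> / 4)) - \<i> * of_real (sgn t * sin (pi * \<gamma> / 4)))))" if "u > 0" for u
      using that by (simp add: \<phi>_def abs_mult powr_mult sgn_mult mult_ac)
    have "(?S powr (1 / (\<gamma> / 2))) powr (\<gamma> / 2) = ?S"
      using S \<gamma> by (simp add: powr_powr)
    then have "\<phi> (?S powr (1 / (\<gamma> / 2)) * t) = \<phi> (A * t) * \<phi> (B * t)"
      using S by (simp only: * AB powr_gt_zero exp_add[symmetric] of_real_add distrib_right)
    then show "char \<mu> (A * t) * char \<mu> (B * t) = char \<mu> (?S powr (1 / (\<gamma> / 2)) * t)"
      by (simp add: \<mu>(2))
  qed (use \<gamma> in auto)
  \<comment> \<open>A point mass has a characteristic function of modulus \<open>1\<close>.\<close>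
  moreover have "\<mu> \<noteq> return borel x" if "\<gamma> < 2" for x
  proof
    assume "\<mu> = return borel x"
    then have "norm (char \<mu> 1) = 1"
      by (simp add: char_def integral_return)
    moreover have "norm (\<phi> 1) = exp (- (K * cos (pi * \<gamma> / 4)))"
      by (simp add: \<phi>_def)
    moreover have "cos (pi * \<gamma> / 4) > 0"
      using \<gamma> that by (intro cos_gt_zero) auto
    ultimately show False using K \<mu>(2)[of 1] by simp
  qed
  moreover have "((\<lambda>a. char (?D a) t) \<longlongrightarrow> char \<mu> t) (at_right 0)" for t
    using char_lim[of t] by (simp only: \<mu>(2))
  moreover have "char \<mu> t =
      exp (- (of_real (\<sigma> * 2 powr \<gamma> * ((1 + b) / (1 - b)) powr (\<gamma> / 2) * \<bar>t\<bar> powr (\<gamma> / 2)) *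
        (of_real (cos (pi * \<gamma> / 4)) - \<i> * of_real (sgn t * sin (pi * \<gamma> / 4)))))" for t
    unfolding \<mu>(2) \<phi>_def K_def c_def by (rule refl)
  ultimately show ?thesis
    using char by (intro conjI exI[of _ \<mu>]) auto
qed

end
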